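(* Let $N\ge 1$, let $P$ be an arbitrary order on $\mathbb{Z}^N$, and let $S$ be a finite nonempty subset of $\mathbb{Z}^N$. Let $$\{0\}=C_0\subset C_1\subset\cdots\subset C_{k-1}\subset C_k=\mathbb{Z}^N$$ be a strictly increasing sequence of subgroups and let $L_1,\dots,L_k:\mathbb{Z}^N\to\mathbb{R}$ be group homomorphisms such that, for $j=1,\dots,k$: (i) $L_j(C_{j-1})=\{0\}$; (ii) $\mathrm{sgn}_P(\chi)=\mathrm{sgn}(L_j(\chi))$ for all $\chi\in C_j\setminus C_{j-1}$. For $j=1,\dots,k$ put $S_j=S\cap(C_j\setminus C_{j-1})$. Then there is a group isomorphism $\psi:\mathbb{Z}^N\to\mathbb{Z}^N$ such that $$\psi(S\cap P)\subset P^*\quad\text{and}\quad \psi(S\cap(-P))\subset(-P^* ),$$ and moreover, for $j=1,\dots,k$, $$\psi(S_j)=(\psi(S))^*_{r(C_j)}.$$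
   Context: An order on an abelian group $\Gamma$ is a subset $P\subset\Gamma$ with $P\cap(-P)=\{0\}$, $P\cup(-P)=\Gamma$, and $P+P=P$. Given an order $P$, $\mathrm{sgn}_P(\chi)$ equals $-1$ if $\chi\in(-P)\setminus\{0\}$, $0$ if $\chi=0$, and $1$ if $\chi\in P\setminus\{0\}$; $\mathrm{sgn}$ denotes the usual sign function on $\mathbb{R}$. The lexicographic order on $\mathbb{Z}^N$ is $$P^*=\{0\}\cup\bigcup_{n=1}^{N}\{(m_1,\dots,m_N)\in\mathbb{Z}^N:\ m_n>0,\ m_{n+1}=\dots=m_N=0\},$$ i.e. $0$ together with the nonzero vectors whose last nonzero coordinate is positive. For a finite nonempty set $T\subset\mathbb{Z}^N$ and $1\le n\le N$, $T^*_n=\{x\in T:\ x_n\ne 0,\ x_{n+1}=\dots=x_N=0\}$. For a subgroup $H$ of $\mathbb{Z}^N$, $r(H)$ denotes its rank (as a free abelian group). It is known that, for every order $P$ on $\mathbb{Z}^N$, subgroups $C_j$ and homomorphisms $L_j$ as in the claim exist. *)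

theory Defs
  imports Complex_Main "HOL-Algebra.Free_Abelian_Groups"
begin

(* Groups are HOL-Algebra groups, whose generic notation is multiplicative: \<one> is the neutral
   element 0, <#> is P + P, and set_inv is -P. *)

definition group_order :: "('a, 'b) monoid_scheme \<Rightarrow> 'a set \<Rightarrow> bool" where
  "group_order G P \<longleftrightarrow>
     P \<subseteq> carrier G \<and>
     P \<inter> (set_inv\<^bsub>G\<^esub> P) = {\<one>\<^bsub>G\<^esub>} \<and>
     P \<union> (set_inv\<^bsub>G\<^esub> P) = carrier G \<and>
     P <#>\<^bsub>G\<^esub> P = P"

(* When P is an order on G, the final case on the carrier is exactly x = \<one>. *)
definition order_sgn :: "('a, 'b) monoid_scheme \<Rightarrow> 'a set \<Rightarrow> 'a \<Rightarrow> real" where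
  "order_sgn G P x =
     (if x \<in> (set_inv\<^bsub>G\<^esub> P) - {\<one>\<^bsub>G\<^esub>} then -1
      else if x \<in> P - {\<one>\<^bsub>G\<^esub>} then 1
      else 0)"

(* Z^N is realised as the integer-valued functions on nat that vanish outside {1..N}, with
   pointwise addition; the coordinate x_n is Poly_Mapping.lookup x n, for 1 <= n <= N. *)
abbreviation int_lattice :: "nat \<Rightarrow> (nat \<Rightarrow>\<^sub>0 int) monoid" where
  "int_lattice N \<equiv> free_Abelian_group {1..N}"

definition real_add_group :: "real monoid" where
  "real_add_group = \<lparr>carrier = UNIV, monoid.mult = (+), one = 0\<rparr>"

(* Meaningful when H is a subgroup of G that is free abelian of finite rank. *)
definition free_rank :: "('a, 'b) monoid_scheme \<Rightarrow> 'a set \<Rightarrow> nat" where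
  "free_rank G H = (THE r. G\<lparr>carrier := H\<rparr> \<cong> int_lattice r)"

definition lex_order :: "nat \<Rightarrow> (nat \<Rightarrow>\<^sub>0 int) set" where
  "lex_order N =
     {0} \<union> (\<Union>n\<in>{1..N}. {m \<in> carrier (int_lattice N).
        Poly_Mapping.lookup m n > 0 \<and> (\<forall>i\<in>{n<..N}. Poly_Mapping.lookup m i = 0)})"

(* The set written T*_n. *)
definition last_nonzero_at :: "nat \<Rightarrow> (nat \<Rightarrow>\<^sub>0 int) set \<Rightarrow> nat \<Rightarrow> (nat \<Rightarrow>\<^sub>0 int) set" where
  "last_nonzero_at N T n =
     {x \<in> T. Poly_Mapping.lookup x n \<noteq> 0 \<and> (\<forall>i\<in>{n<..N}. Poly_Mapping.lookup x i = 0)}"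

end

theory Submission
  imports Defs "HOL-Analysis.Kronecker_Approximation_Theorem"
begin

text \<open>
  The map is built one coordinate at a time, from the last one down, by induction on the rank.
  Let \<open>H\<close> be a lattice with a chain ending in \<open>H\<close>, let \<open>D\<close> be the last proper member of the
  chain and \<open>L\<close> its functional, so that \<open>D = ker L\<close>. Dirichlet's simultaneous approximation of the
  values of \<open>L\<close> on a basis of \<open>H\<close> gives an integral functional \<open>l\<close> close to a positive multiple
  of \<open>L\<close> on any prescribed finite set. On the elements of \<open>S\<close> outside \<open>D\<close> it has the sign of
  \<open>L\<close>; on a finite set of generators of \<open>D\<close> it is an integer of absolute value less than 1, hence
  it vanishes on \<open>D\<close>. Divided by the generator of its image, \<open>l\<close> becomes surjective, so \<open>H\<close>
  splits as \<open>ker l \<oplus> \<int>\<close> with \<open>l\<close> as last coordinate, and the induction continues with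
  \<open>ker l\<close> and the chain \<open>C\<^sub>j \<inter> ker l\<close>.
\<close>

(* HOL-Analysis uses \<chi> as a binder, but it is a variable name in the theorem. *)
unbundle no vec_syntax

section \<open>Subgroups, additive maps and coordinates on finitely generated lattices\<close>

text \<open>The type itself is an abelian group, so no ambient carrier is fixed: kernels and
  intersections of subgroups can be treated without reference to \<open>N\<close>.\<close>

definition additive_subgroup :: "('a \<Rightarrow>\<^sub>0 int) set \<Rightarrow> bool" where
  "additive_subgroup H \<longleftrightarrow> 0 \<in> H \<and> (\<forall>x\<in>H. \<forall>y\<in>H. x - y \<in> H)"

definition additive_on :: "'a::ab_group_add set \<Rightarrow> ('a \<Rightarrow> 'b::ab_group_add) \<Rightarrow> bool" where
  "additive_on H g \<longleftrightarrow> (\<forall>x\<in>H. \<forall>y\<in>H. g (x + y) = g x + g y)"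

text \<open>The map \<open>f\<close> is total, but only its values on \<open>H\<close> matter. Since
  the lattices \<open>int_lattice n\<close> are nested inside one type, a single map can serve as
  coordinates for a whole chain: \<open>lattice_coords r (C j) f\<close> then says that
  \<open>f\<close> carries \<open>C j\<close> onto the vectors supported on the first
  \<open>r\<close> coordinates.\<close>

definition lattice_coords :: "nat \<Rightarrow> ('a \<Rightarrow>\<^sub>0 int) set \<Rightarrow> (('a \<Rightarrow>\<^sub>0 int) \<Rightarrow> (nat \<Rightarrow>\<^sub>0 int)) \<Rightarrow> bool" where
  "lattice_coords n H f \<longleftrightarrow>
     additive_subgroup H \<and> additive_on H f \<and> bij_betw f H (carrier (int_lattice n))"

lemma additive_subgroup_0: "additive_subgroup H \<Longrightarrow> 0 \<in> H"
  and additive_subgroup_diff: "additive_subgroup H \<Longrightarrow> x \<in> H \<Longrightarrow> y \<in> H \<Longrightarrow> x - y \<in> H"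
  by (auto simp: additive_subgroup_def)

lemma additive_subgroup_minus: "additive_subgroup H \<Longrightarrow> x \<in> H \<Longrightarrow> - x \<in> H"
  using additive_subgroup_diff[of H 0 x] additive_subgroup_0[of H] by simp

lemma additive_subgroup_add: "additive_subgroup H \<Longrightarrow> x \<in> H \<Longrightarrow> y \<in> H \<Longrightarrow> x + y \<in> H"
  using additive_subgroup_diff[of H x "- y"] additive_subgroup_minus[of H y] by simp

lemma additive_onD: "additive_on H g \<Longrightarrow> x \<in> H \<Longrightarrow> y \<in> H \<Longrightarrow> g (x + y) = g x + g y"
  by (auto simp: additive_on_def)

lemma additive_on_subset: "additive_on H g \<Longrightarrow> K \<subseteq> H \<Longrightarrow> additive_on K g"
  by (auto simp: additive_on_def)

lemma additive_on_0: "additive_on H g \<Longrightarrow> additive_subgroup H \<Longrightarrow> g 0 = 0"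
  using additive_onD[of H g 0 0] additive_subgroup_0[of H] by simp

lemma additive_on_diff:
  assumes "additive_on H g" "additive_subgroup H" "x \<in> H" "y \<in> H"
  shows "g (x - y) = g x - g y"
  using additive_onD[OF assms(1) additive_subgroup_diff[OF assms(2-4)] assms(4)]
  by (simp add: algebra_simps)

lemma frag_cmul_add_left: "frag_cmul (c + d) x = frag_cmul c x + frag_cmul d x"
  by (rule poly_mapping_eqI) (simp add: lookup_add algebra_simps)

lemma frag_cmul_diff_left: "frag_cmul (c - d) x = frag_cmul c x - frag_cmul d x"
  by (rule poly_mapping_eqI) (simp add: lookup_minus algebra_simps)

lemma additive_subgroup_cmul:
  assumes "additive_subgroup H" "x \<in> H"
  shows "frag_cmul c x \<in> H"
proof (induction c rule: int_induct[where k = 0])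
  case base
  then show ?case using assms additive_subgroup_0 by simp
next
  case (step1 i)
  then show ?case using assms by (simp add: frag_cmul_add_left additive_subgroup_add)
next
  case (step2 i)
  then show ?case using assms by (simp add: frag_cmul_diff_left additive_subgroup_diff)
qed

lemma additive_on_cmul:
  fixes g :: "('a \<Rightarrow>\<^sub>0 int) \<Rightarrow> int"
  assumes "additive_subgroup H" "additive_on H g" "x \<in> H"
  shows "g (frag_cmul c x) = c * g x"
proof (induction c rule: int_induct[where k = 0])
  case base
  then show ?case using assms additive_on_0 by simp
next
  case (step1 i)
  then show ?case
    using assms by (simp add: frag_cmul_add_left additive_onD additive_subgroup_cmul algebra_simps)
next
  case (step2 i)
  then show ?case
    using assms by (simp add: frag_cmul_diff_left additive_on_diff additive_subgroup_cmul algebra_simps)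
qed

lemma additive_subgroup_Int:
  "additive_subgroup H \<Longrightarrow> additive_subgroup K \<Longrightarrow> additive_subgroup (H \<inter> K)"
  by (auto simp: additive_subgroup_def)

lemma additive_subgroup_kernel:
  fixes g :: "('a \<Rightarrow>\<^sub>0 int) \<Rightarrow> 'b::ab_group_add"
  shows "additive_subgroup H \<Longrightarrow> additive_on H g \<Longrightarrow> additive_subgroup {x \<in> H. g x = 0}"
  unfolding additive_subgroup_def[of "{x \<in> H. g x = 0}"]
  by (auto simp: additive_on_diff additive_on_0 additive_subgroup_0 additive_subgroup_diff)

lemma lattice_coordsD:
  assumes "lattice_coords n H f"
  shows "additive_subgroup H" "additive_on H f" "inj_on f H" "f ` H = carrier (int_lattice n)"
  using assms by (auto simp: lattice_coords_def bij_betw_def)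

lemma lattice_coords_keys:
  assumes "lattice_coords n H f" "x \<in> H"
  shows "Poly_Mapping.keys (f x) \<subseteq> {1..n}"
  using imageI[OF assms(2), of f] unfolding lattice_coordsD(4)[OF assms(1)] by simp

lemma lattice_coords_surj:
  assumes "lattice_coords n H f" "Poly_Mapping.keys y \<subseteq> {1..n}"
  obtains x where "x \<in> H" "f x = y"
proof -
  have "y \<in> f ` H" using assms(2) unfolding lattice_coordsD(4)[OF assms(1)] by simp
  then show thesis using that by blast
qed

lemma lattice_coords_cong:
  assumes "lattice_coords n H f" "\<And>x. x \<in> H \<Longrightarrow> f x = g x"
  shows "lattice_coords n H g"
proof -
  have "additive_on H g"
    using assms(2) lattice_coordsD(1,2)[OF assms(1)] additive_subgroup_add[of H]
    unfolding additive_on_def by metis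
  moreover have "bij_betw g H (carrier (int_lattice n))"
    using assms bij_betw_cong[of H f g] by (simp add: lattice_coords_def)
  ultimately show ?thesis using assms(1) by (simp add: lattice_coords_def)
qed

section \<open>Invariance of the rank\<close>

lemma int_lattice_iso_iff: "int_lattice m \<cong> int_lattice n \<longleftrightarrow> m = n"
  by (simp add: isomorphic_free_Abelian_groups eqpoll_iff_card)

lemma lattice_coords_iso:
  assumes "lattice_coords n H f" "H \<subseteq> carrier (free_Abelian_group A)"
  shows "(free_Abelian_group A)\<lparr>carrier := H\<rparr> \<cong> int_lattice n"
proof -
  have "f \<in> iso ((free_Abelian_group A)\<lparr>carrier := H\<rparr>) (int_lattice n)"
    using assms unfolding iso_def hom_def lattice_coords_def additive_on_def bij_betw_def
    by auto
  then show ?thesis by (auto simp: is_iso_def)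
qed

text \<open>\<open>H\<close> is regarded as a subgroup of the free abelian group on the whole type;
  two coordinate systems then make two standard lattices isomorphic, which forces equal
  ranks.\<close>

lemma lattice_coords_unique:
  assumes "lattice_coords m H f" "lattice_coords n H g"
  shows "m = n"
proof -
  let ?G = "(free_Abelian_group UNIV)\<lparr>carrier := H\<rparr>"
  have H: "H \<subseteq> carrier (free_Abelian_group UNIV)" by auto
  have "subgroup H (free_Abelian_group UNIV)"
    using lattice_coordsD(1)[OF assms(1)] additive_subgroup_0[OF lattice_coordsD(1)[OF assms(1)]]
    by (auto intro!: group.subgroupI
        simp: additive_subgroup_minus additive_subgroup_add)
  then have "group ?G"
    by (intro subgroup.subgroup_is_group) auto
  then have "int_lattice m \<cong> ?G"
    using lattice_coords_iso[OF assms(1) H] by (rule group.iso_sym)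
  also have "?G \<cong> int_lattice n"
    using assms(2) H by (rule lattice_coords_iso)
  finally show ?thesis by (simp only: int_lattice_iso_iff)
qed

text \<open>Coordinates on \<open>H\<close> witness the existence part of the definite description;
  uniqueness comes from the invariance of the rank.\<close>

lemma free_rank_eq:
  assumes "lattice_coords n H f" "H \<subseteq> carrier (int_lattice N)"
  shows "free_rank (int_lattice N) H = n"
  unfolding free_rank_def
proof (rule the_equality)
  show iso: "(int_lattice N)\<lparr>carrier := H\<rparr> \<cong> int_lattice n"
    by (rule lattice_coords_iso[OF assms])
  fix r assume r: "(int_lattice N)\<lparr>carrier := H\<rparr> \<cong> int_lattice r"
  have "subgroup H (int_lattice N)"
    using assms lattice_coordsD(1)[OF assms(1)] additive_subgroup_0[OF lattice_coordsD(1)[OF assms(1)]]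
    by (auto intro!: group.subgroupI
        simp: additive_subgroup_minus additive_subgroup_add subset_iff)
  then have "group ((int_lattice N)\<lparr>carrier := H\<rparr>)"
    by (intro subgroup.subgroup_is_group) auto
  then have "int_lattice n \<cong> (int_lattice N)\<lparr>carrier := H\<rparr>"
    using iso group.iso_sym by blast
  also note r
  finally show "r = n" by (simp only: int_lattice_iso_iff)
qed

section \<open>Integral functionals and splitting off a coordinate\<close>

text \<open>The preimages under \<open>f\<close> of the unit vectors form a basis of
  \<open>H\<close>, and an additive map is determined by its values there. The induction runs over
  the coordinate vector, pulled back to \<open>H\<close> by the inverse of \<open>f\<close>.\<close>

lemma additive_on_expansion:
  fixes g :: "('a \<Rightarrow>\<^sub>0 int) \<Rightarrow> 'b::ring_1"
  assumes f: "lattice_coords n H f" and g: "additive_on H g" and x: "x \<in> H"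
  shows "g x = (\<Sum>i=1..n. of_int (Poly_Mapping.lookup (f x) i) * g (inv_into H f (frag_of i)))"
proof -
  note fD = lattice_coordsD[OF f]
  define h where "h = inv_into H f"
  have hH: "h y \<in> H" and fh: "f (h y) = y" if "y \<in> carrier (int_lattice n)" for y
    using that fD(4) inv_into_into[of y f H] f_inv_into_f[of y f H] by (auto simp: h_def)
  have hf: "h (f x) = x" if "x \<in> H" for x
    using that fD(3) by (simp add: h_def)
  have h_diff: "h (y - z) = h y - h z"
    if "y \<in> carrier (int_lattice n)" "z \<in> carrier (int_lattice n)" for y z
  proof -
    have "f (h y - h z) = y - z"
      using that by (simp add: additive_on_diff[OF fD(2,1)] hH fh)
    then show ?thesis
      using hf additive_subgroup_diff[OF fD(1)] hH that by metis
  qed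
  have h0: "h 0 = 0"
    using hf[of 0] additive_subgroup_0[OF fD(1)] additive_on_0[OF fD(2,1)] by simp
  have "y \<in> carrier (int_lattice n) \<and>
      g (h y) = (\<Sum>i=1..n. of_int (Poly_Mapping.lookup y i) * g (h (frag_of i)))"
    if "y \<in> carrier (int_lattice n)" for y
    using that[unfolded carrier_free_Abelian_group_iff]
  proof (induction y rule: frag_induction)
    case zero
    show ?case using h0 additive_on_0[OF g fD(1)] by simp
  next
    case (one i)
    have "(\<Sum>j=1..n. of_int (Poly_Mapping.lookup (frag_of i) j) * g (h (frag_of j)))
        = (\<Sum>j\<in>{1..n}. if i = j then g (h (frag_of j)) else 0)"
      by (rule sum.cong) auto
    then show ?case using one by simp
  next
    case (diff a b)
    then have "a - b \<in> carrier (int_lattice n)"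
      using keys_diff[of a b] by auto
    then show ?case
      using diff by (simp add: h_diff additive_on_diff[OF g fD(1)] hH lookup_minus
          algebra_simps sum_subtractf)
  qed
  from this[of "f x"] show ?thesis
    using lattice_coords_keys[OF f x] hf[OF x] by (simp add: h_def)
qed

text \<open>Since \<open>l e = 1\<close>, \<open>K\<close> is the direct sum of the kernel of
  \<open>l\<close> and the multiples of \<open>e\<close>. Coordinates of the kernel part are kept,
  and \<open>l\<close> is appended as the last coordinate; on the kernel itself the new map agrees
  with \<open>g\<close>.\<close>

lemma lattice_coords_extend:
  fixes l :: "('a \<Rightarrow>\<^sub>0 int) \<Rightarrow> int"
  assumes K: "additive_subgroup K" and l: "additive_on K l" and e: "e \<in> K" "l e = 1"
    and g: "lattice_coords m {x \<in> K. l x = 0} g"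
  shows "lattice_coords (Suc m) K
           (\<lambda>x. g (x - frag_cmul (l x) e) + frag_cmul (l x) (frag_of (Suc m)))"
    (is "lattice_coords _ _ ?f")
proof -
  \<comment> \<open>The projection onto the kernel of \<open>l\<close> along
    \<open>e\<close>.\<close>
  define p where "p = (\<lambda>x. x - frag_cmul (l x) e)"
  define K0 where "K0 = {x \<in> K. l x = 0}"
  note gD = lattice_coordsD[OF g, folded K0_def]
  have p: "p x \<in> K0" if "x \<in> K" for x
    using that K l e by (simp add: p_def K0_def additive_subgroup_diff additive_subgroup_cmul
        additive_on_diff additive_on_cmul)
  have p_add: "p (x + y) = p x + p y" if "x \<in> K" "y \<in> K" for x y
    using that by (simp add: p_def additive_onD[OF l] frag_cmul_add_left)
  have f: "?f x = g (p x) + frag_cmul (l x) (frag_of (Suc m))" for x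
    by (simp add: p_def)
  have gK: "Poly_Mapping.keys (g y) \<subseteq> {1..m}" if "y \<in> K0" for y
    using lattice_coords_keys[OF g] that by (simp add: K0_def)
  have last: "Poly_Mapping.lookup (?f x) (Suc m) = l x" if "x \<in> K" for x
  proof -
    have "Suc m \<notin> Poly_Mapping.keys (g (p x))" using gK[OF p[OF that]] by auto
    then show ?thesis by (simp add: f lookup_add in_keys_iff)
  qed
  have "additive_on K ?f"
    unfolding additive_on_def f
    by (simp add: p_add additive_onD[OF l] additive_onD[OF gD(2)] p frag_cmul_add_left)
  moreover have "inj_on ?f K"
  proof (rule inj_onI)
    fix x y assume xy: "x \<in> K" "y \<in> K" "?f x = ?f y"
    then have lxy: "l x = l y" using last by metis
    then have "g (p x) = g (p y)" using xy(3) unfolding f by simp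
    then have "p x = p y" using gD(3) p xy by (auto dest: inj_onD)
    then show "x = y" using lxy by (simp add: p_def)
  qed
  moreover have "?f ` K = carrier (int_lattice (Suc m))"
  proof (intro equalityI subsetI)
    fix y assume "y \<in> ?f ` K"
    then obtain x where x: "x \<in> K" "y = g (p x) + frag_cmul (l x) (frag_of (Suc m))"
      by (auto simp: f)
    have "Poly_Mapping.keys y \<subseteq> Poly_Mapping.keys (g (p x)) \<union> {Suc m}"
      unfolding x(2) using keys_add[of "g (p x)"] keys_cmul[of "l x" "frag_of (Suc m)"] by fastforce
    also have "\<dots> \<subseteq> {1..Suc m}" using gK[OF p[OF x(1)]] by auto
    finally show "y \<in> carrier (int_lattice (Suc m))" by simp
  next
    fix y assume "y \<in> carrier (int_lattice (Suc m))"
    then have y: "Poly_Mapping.keys y \<subseteq> {1..Suc m}" by simp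
    define c where "c = Poly_Mapping.lookup y (Suc m)"
    \<comment> \<open>Surjectivity: strip the last coordinate from \<open>y\<close>, lift the rest
      to the kernel, and add back \<open>c\<close> copies of \<open>e\<close>.\<close>
    define z where "z = y - frag_cmul c (frag_of (Suc m))"
    have "Poly_Mapping.keys z \<subseteq> {1..m}"
    proof
      fix i assume i: "i \<in> Poly_Mapping.keys z"
      then have "i \<noteq> Suc m" by (auto simp: z_def c_def in_keys_iff lookup_minus)
      moreover have "i \<in> {1..Suc m}"
        using i y keys_diff[of y "frag_cmul c (frag_of (Suc m))"]
          keys_cmul[of c "frag_of (Suc m)"] by (force simp: z_def)
      ultimately show "i \<in> {1..m}" by auto
    qed
    then obtain w where w: "w \<in> K0" "g w = z"
      using lattice_coords_surj[OF g] unfolding K0_def by metis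
    define x where "x = w + frag_cmul c e"
    have wK: "w \<in> K" "l w = 0" using w by (auto simp: K0_def)
    have x: "x \<in> K" using wK K e by (simp add: x_def additive_subgroup_add additive_subgroup_cmul)
    have lx: "l x = c"
      using wK K e l by (simp add: x_def additive_onD additive_subgroup_cmul additive_on_cmul)
    have "?f x = y" unfolding f by (simp add: p_def lx) (simp add: x_def w z_def)
    then show "y \<in> ?f ` K" using x by blast
  qed
  ultimately show ?thesis
    using K by (simp add: lattice_coords_def bij_betw_def)
qed

text \<open>The image of \<open>l\<close> is a nonzero subgroup of the integers, generated by its
  least positive value \<open>d\<close>, attained at \<open>e\<close>. Dividing \<open>l\<close> by
  \<open>d\<close> makes it surjective.\<close>

lemma primitive_functional:
  fixes l :: "('a \<Rightarrow>\<^sub>0 int) \<Rightarrow> int"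
  assumes K: "additive_subgroup K" and l: "additive_on K l" and x0: "x0 \<in> K" "l x0 \<noteq> 0"
  obtains d l' e where "d > 0" "additive_on K l'" "e \<in> K" "l' e = 1"
    "\<And>x. x \<in> K \<Longrightarrow> l x = d * l' x"
proof -
  define Q where "Q = (\<lambda>n::nat. n > 0 \<and> (\<exists>x\<in>K. l x = int n))"
  have "\<exists>n. Q n"
  proof -
    have "l (frag_cmul (sgn (l x0)) x0) = int (nat \<bar>l x0\<bar>)"
      using additive_on_cmul[OF K l x0(1)] by (simp add: sgn_mult_self_eq mult_sgn_abs) (simp add: sgn_if)
    then show ?thesis
      unfolding Q_def using x0 additive_subgroup_cmul[OF K x0(1)] by (metis zero_less_nat_eq zero_less_abs_iff)
  qed
  then have Q: "Q (LEAST n. Q n)" by (rule LeastI_ex)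
  define d where "d = int (LEAST n. Q n)"
  obtain e where e: "e \<in> K" "l e = d" and d: "d > 0"
    using Q unfolding d_def Q_def by auto
  have dvd: "d dvd l x" if x: "x \<in> K" for x
  proof (rule ccontr)
    \<comment> \<open>Otherwise the remainder modulo \<open>d\<close> is a smaller positive value of
      \<open>l\<close>, attained after subtracting a multiple of \<open>e\<close>.\<close>
    assume "\<not> d dvd l x"
    then have pos: "l x mod d > 0"
      using d by (metis dvd_eq_mod_eq_0 order_le_less pos_mod_sign)
    have "x - frag_cmul (l x div d) e \<in> K"
      using K x e by (simp add: additive_subgroup_diff additive_subgroup_cmul)
    moreover have "l (x - frag_cmul (l x div d) e) = int (nat (l x mod d))"
      using K x e l pos by (simp add: additive_on_diff additive_subgroup_cmul additive_on_cmul
          minus_div_mult_eq_mod)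
    ultimately have "Q (nat (l x mod d))" unfolding Q_def using pos by auto
    then have "(LEAST n. Q n) \<le> nat (l x mod d)" by (rule Least_le)
    then have "d \<le> l x mod d" using pos by (simp add: d_def)
    then show False using d pos_mod_bound[of d "l x"] by linarith
  qed
  show thesis
  proof (rule that[of d "\<lambda>x. l x div d" e])
    show "additive_on K (\<lambda>x. l x div d)"
      unfolding additive_on_def using additive_onD[OF l] dvd by (simp add: div_plus_div_distrib_dvd_left)
  qed (use d e dvd in auto)
qed

text \<open>Subgroups of finitely generated free abelian groups are again such. Induction on the
  rank: either \<open>K\<close> lies in the kernel of the last coordinate, or that coordinate, made
  primitive on \<open>K\<close>, splits \<open>K\<close>.\<close>

lemma lattice_coords_subgroup:
  "lattice_coords n H f \<Longrightarrow> additive_subgroup K \<Longrightarrow> K \<subseteq> H \<Longrightarrow> \<exists>m g. lattice_coords m K g"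
proof (induction n arbitrary: H K f)
  case 0
  then have "f ` H = {0}" "inj_on f H" using lattice_coordsD[OF 0(1)] by auto
  then have "K = {0}"
    using 0 additive_subgroup_0[OF 0(2)] by (auto simp: inj_on_def image_def set_eq_iff subset_iff) metis
  then have "lattice_coords 0 K (\<lambda>_. 0)"
    using 0(2) by (auto simp: lattice_coords_def additive_on_def bij_betw_def)
  then show ?case by blast
next
  case (Suc n)
  note fD = lattice_coordsD[OF Suc.prems(1)]
  define l where "l = (\<lambda>x. Poly_Mapping.lookup (f x) (Suc n))"
  have l: "additive_on H l"
    using fD(2) by (auto simp: additive_on_def l_def lookup_add)
  have H0: "lattice_coords n {x \<in> H. l x = 0} f"
  proof -
    have "f ` {x \<in> H. l x = 0} = carrier (int_lattice n)"
    proof (intro equalityI subsetI)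
      fix y assume "y \<in> f ` {x \<in> H. l x = 0}"
      then have "Poly_Mapping.keys y \<subseteq> {1..Suc n}" "Suc n \<notin> Poly_Mapping.keys y"
        using lattice_coords_keys[OF Suc.prems(1)] by (auto simp: l_def in_keys_iff simp del: atLeastAtMost_iff)
      then show "y \<in> carrier (int_lattice n)" by (auto simp: atLeastAtMostSuc_conv)
    next
      fix y assume "y \<in> carrier (int_lattice n)"
      then have y: "Poly_Mapping.keys y \<subseteq> {1..n}" by simp
      then have "Poly_Mapping.keys y \<subseteq> {1..Suc n}" "Poly_Mapping.lookup y (Suc n) = 0"
        by (auto simp: subset_iff in_keys_iff)
      moreover from this obtain x where "x \<in> H" "f x = y"
        using lattice_coords_surj[OF Suc.prems(1)] by metis
      ultimately show "y \<in> f ` {x \<in> H. l x = 0}" by (auto simp: l_def)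
    qed
    then show ?thesis
      using additive_subgroup_kernel[OF fD(1) l] additive_on_subset[OF fD(2), of "{x \<in> H. l x = 0}"]
        inj_on_subset[OF fD(3), of "{x \<in> H. l x = 0}"]
      by (auto simp: lattice_coords_def bij_betw_def)
  qed
  have lK: "additive_on K l" using l Suc.prems(3) by (rule additive_on_subset)
  show ?case
  proof (cases "\<forall>x\<in>K. l x = 0")
    case True
    then show ?thesis using Suc.IH[OF H0 Suc.prems(2)] Suc.prems(3) by blast
  next
    case False
    then obtain x0 where "x0 \<in> K" "l x0 \<noteq> 0" by blast
    then obtain d l' e where l': "d > 0" "additive_on K l'" "e \<in> K" "l' e = 1"
        "\<And>x. x \<in> K \<Longrightarrow> l x = d * l' x"
      using primitive_functional[OF Suc.prems(2) lK] by metis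
    have "additive_subgroup {x \<in> K. l' x = 0}"
      using additive_subgroup_kernel[OF Suc.prems(2) l'(2)] .
    \<comment> \<open>As \<open>l\<close> is a multiple of \<open>l'\<close> on \<open>K\<close>,
      this kernel lies in the sublattice of rank \<open>n\<close>, where the induction hypothesis
      applies.\<close>
    moreover have "{x \<in> K. l' x = 0} \<subseteq> {x \<in> H. l x = 0}"
      using l' Suc.prems(3) by auto
    ultimately obtain m g where "lattice_coords m {x \<in> K. l' x = 0} g"
      using Suc.IH[OF H0] by blast
    from lattice_coords_extend[OF Suc.prems(2) l'(2-4) this] show ?thesis by blast
  qed
qed

section \<open>Integral functionals from simultaneous Diophantine approximation\<close>

text \<open>Replaces the real functional by an integral one without losing its signs on
  \<open>F\<close> or its kernel. The kernel may grow, since \<open>L\<close> can have values that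
  are rationally independent.\<close>

lemma lattice_coords_approx:
  fixes L :: "('a \<Rightarrow>\<^sub>0 int) \<Rightarrow> real"
  assumes f: "lattice_coords n H f" and L: "additive_on H L"
    and F: "finite F" "F \<subseteq> H" "\<And>x. x \<in> F \<Longrightarrow> L x \<noteq> 0"
  obtains l :: "('a \<Rightarrow>\<^sub>0 int) \<Rightarrow> int"
    where "additive_on H l" "\<And>x. x \<in> H \<Longrightarrow> L x = 0 \<Longrightarrow> l x = 0"
      "\<And>x. x \<in> F \<Longrightarrow> of_int (sgn (l x)) = sgn (L x)"
proof -
  note fD = lattice_coordsD[OF f]
  define K where "K = {x \<in> H. L x = 0}"
  have K: "additive_subgroup K" "K \<subseteq> H"
    using additive_subgroup_kernel[OF fD(1) L] by (auto simp: K_def)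
  obtain m g where g: "lattice_coords m K g"
    using lattice_coords_subgroup[OF f K] by blast
  define b where "b = (\<lambda>i. inv_into K g (frag_of i))"
  have bK: "b i \<in> K" if "i \<in> {1..m}" for i
    using lattice_coordsD(4)[OF g] that unfolding b_def by (intro inv_into_into) simp
  define \<theta> where "\<theta> = (\<lambda>i. L (inv_into H f (frag_of i)))"
  have Lx: "L x = (\<Sum>i=1..n. of_int (Poly_Mapping.lookup (f x) i) * \<theta> i)" if "x \<in> H" for x
    using additive_on_expansion[OF f L that] by (simp add: \<theta>_def)
  \<comment> \<open>The finite test set: a basis of the kernel of \<open>L\<close> together with
    \<open>F\<close>. The sum \<open>s\<close> is the l1-norm of the coordinates, which controls how
    errors on the basis propagate.\<close>
  define E where "E = b ` {1..m} \<union> F"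
  define s where "s = (\<lambda>x. \<Sum>i=1..n. real_of_int \<bar>Poly_Mapping.lookup (f x) i\<bar>)"
  have s0: "s x \<ge> 0" for x by (simp add: s_def sum_nonneg)
  have EH: "E \<subseteq> H" "finite E" using bK K F by (auto simp: E_def)
  define B where "B = (\<Sum>x\<in>E. s x)"
  have sB: "s x \<le> B" if "x \<in> E" for x
    unfolding B_def using that EH(2) s0 by (intro member_le_sum) auto
  \<comment> \<open>The bound 1 will force integers to vanish on the kernel, the bounds by absolute
    values of \<open>L\<close> will preserve signs on \<open>F\<close>. The inserted 1 also covers
    empty \<open>F\<close>.\<close>
  define \<delta> where "\<delta> = Min (insert 1 ((\<lambda>x. \<bar>L x\<bar>) ` F))"
  have \<delta>: "\<delta> > 0" "\<delta> \<le> 1" and \<delta>F: "\<And>x. x \<in> F \<Longrightarrow> \<delta> \<le> \<bar>L x\<bar>"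
    using F(1,3) by (auto simp: \<delta>_def)
  \<comment> \<open>Large enough that \<open>B / M\<close> is below \<open>\<delta>\<close>; the
    summand 1 makes \<open>M\<close> positive even when \<open>B\<close> is 0.\<close>
  obtain M :: nat where M: "real M > (B + 1) / \<delta>"
    using reals_Archimedean2 by blast
  have B0: "B \<ge> 0" unfolding B_def by (simp add: sum_nonneg s0)
  then have "M > 0" using M \<delta> by (metis add_nonneg_pos divide_pos_pos less_trans of_nat_0_less_iff zero_less_one)
  then obtain q p where q: "0 < q"
    and p: "\<And>i. i < Suc n \<Longrightarrow> \<bar>of_int q * \<theta> i - of_int (p i)\<bar> < 1 / M"
    \<comment> \<open>The approximation theorem indexes from 0, so \<open>Suc n\<close> values are
      taken to reach the coordinates 1 to \<open>n\<close>.\<close>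
    using Dirichlet_approx_simult[of M "Suc n" \<theta>] by metis
  define l where "l = (\<lambda>x. \<Sum>i=1..n. Poly_Mapping.lookup (f x) i * p i)"
  have l: "additive_on H l"
    unfolding additive_on_def l_def
    by (simp add: additive_onD[OF fD(2)] lookup_add algebra_simps sum.distrib)
  have close: "\<bar>of_int q * L x - of_int (l x)\<bar> < \<delta>" if "x \<in> E" for x
  proof -
    have "of_int q * L x - of_int (l x)
        = (\<Sum>i=1..n. of_int (Poly_Mapping.lookup (f x) i) * (of_int q * \<theta> i - of_int (p i)))"
      using that EH by (subst Lx) (auto simp: l_def sum_distrib_left algebra_simps sum_subtractf)
    also have "\<bar>\<dots>\<bar> \<le> (\<Sum>i=1..n. \<bar>of_int (Poly_Mapping.lookup (f x) i) * (of_int q * \<theta> i - of_int (p i))\<bar>)"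
      by (rule sum_abs)
    also have "\<dots> \<le> (\<Sum>i=1..n. real_of_int \<bar>Poly_Mapping.lookup (f x) i\<bar> * (1 / M))"
    proof (rule sum_mono)
      fix i assume "i \<in> {1..n}"
      then have "\<bar>of_int q * \<theta> i - of_int (p i)\<bar> \<le> 1 / M" using p[of i] by simp
      then show "\<bar>of_int (Poly_Mapping.lookup (f x) i) * (of_int q * \<theta> i - of_int (p i))\<bar>
          \<le> real_of_int \<bar>Poly_Mapping.lookup (f x) i\<bar> * (1 / M)"
        unfolding abs_mult by (intro mult_mono) auto
    qed
    also have "\<dots> = s x / M" by (simp add: s_def sum_divide_distrib)
    also have "\<dots> \<le> B / M" using sB[OF that] by (simp add: divide_right_mono)
    also have "\<dots> < \<delta>"
    proof -
      have "B < real M * \<delta>" using M \<delta> by (simp add: pos_divide_less_eq)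
      then show ?thesis using \<open>M > 0\<close> by (simp add: pos_divide_less_eq mult.commute)
    qed
    finally show ?thesis .
  qed
  show thesis
  proof (rule that[OF l])
    fix x assume x: "x \<in> H" "L x = 0"
    \<comment> \<open>Here \<open>L (b i)\<close> is 0, so closeness says that the integer
      \<open>l (b i)\<close> has absolute value below 1.\<close>
    have "l (b i) = 0" if "i \<in> {1..m}" for i
    proof -
      have "\<bar>real_of_int (l (b i))\<bar> < 1"
        using close[of "b i"] that bK[OF that] \<delta>(2) by (simp add: E_def K_def)
      then show ?thesis by linarith
    qed
    moreover have "x \<in> K" using x by (simp add: K_def)
    ultimately show "l x = 0"
      using additive_on_expansion[OF g additive_on_subset[OF l K(2)]] by (simp add: b_def)
  next
    fix x assume x: "x \<in> F"
    have c: "\<bar>of_int q * L x - of_int (l x)\<bar> < \<bar>L x\<bar>"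
      using close[of x] \<delta>F[OF x] x by (simp add: E_def)
    \<comment> \<open>Multiplying by \<open>q\<close> does not shrink \<open>L x\<close>, whereas
      the error is smaller than its absolute value, so the sign survives.\<close>
    have q1: "real_of_int q \<ge> 1" using q by linarith
    show "of_int (sgn (l x)) = sgn (L x)"
    proof (cases "L x > 0")
      case True
      then have "of_int q * L x \<ge> L x" using mult_right_mono[OF q1, of "L x"] by simp
      then have "real_of_int (l x) > 0" using c True by linarith
      then show ?thesis using True by simp
    next
      case False
      then have neg: "L x < 0" using F(3)[OF x] by linarith
      then have "of_int q * L x \<le> L x" using mult_right_mono_neg[OF q1, of "L x"] by simp
      then have "real_of_int (l x) < 0" using c neg by linarith
      then show ?thesis using neg by simp
    qed
  qed
qed

section \<open>Coordinates adapted to a chain of subgroups\<close>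

text \<open>The chain need only be weakly increasing: intersecting it with a subgroup can merge members.\<close>

lemma adapted_lattice_coords:
  fixes C :: "nat \<Rightarrow> ('a \<Rightarrow>\<^sub>0 int) set" and L :: "nat \<Rightarrow> ('a \<Rightarrow>\<^sub>0 int) \<Rightarrow> real"
  assumes "lattice_coords n H f"
    and "\<And>j. j \<le> k \<Longrightarrow> additive_subgroup (C j)" "C 0 = {0}" "C k = H"
    and "\<And>j. j \<in> {1..k} \<Longrightarrow> C (j - 1) \<subseteq> C j"
    and "\<And>j. j \<in> {1..k} \<Longrightarrow> additive_on H (L j)"
    and "\<And>j x. j \<in> {1..k} \<Longrightarrow> x \<in> C (j - 1) \<Longrightarrow> L j x = 0"
    and "\<And>j x. j \<in> {1..k} \<Longrightarrow> x \<in> C j - C (j - 1) \<Longrightarrow> L j x \<noteq> 0"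
    and "finite S" "S \<subseteq> H"
  shows "\<exists>\<psi>. lattice_coords n H \<psi> \<and>
    (\<forall>j\<in>{1..k}. \<exists>r. lattice_coords r (C j) \<psi> \<and>
       (\<forall>x\<in>S \<inter> (C j - C (j - 1)). of_int (sgn (Poly_Mapping.lookup (\<psi> x) r)) = sgn (L j x)))"
  using assms
proof (induction n arbitrary: H f C S)
  case 0
  have H: "additive_subgroup H" "inj_on f H" "f ` H = {0}"
    using lattice_coordsD[OF 0(1)] by auto
  note H_0 = additive_subgroup_0[OF H(1)]
  have f0: "f x = 0" if "x \<in> H" for x
    using imageI[OF that, of f] unfolding H(3) by simp
  have "x = 0" if "x \<in> H" for x
    using inj_onD[OF H(2) _ that H_0] f0[OF that] f0[OF H_0] by simp
  then have H0: "H = {0}" using H_0 by auto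
  \<comment> \<open>In rank 0 every member is trivial, so all differences of neighbours are empty
    and \<open>r = 0\<close> serves for every \<open>j\<close>.\<close>
  have C: "C j = {0}" if "j \<le> k" for j
    using that
  proof (induction j rule: inc_induct)
    case base
    then show ?case using H0 0(4) by simp
  next
    case (step j)
    then have "C j \<subseteq> {0}" using 0(5)[of "Suc j"] by simp
    then show ?case using additive_subgroup_0[OF 0(2)[of j]] step by auto
  qed
  have "\<forall>j\<in>{1..k}. C j - C (j - 1) = {}" using C by auto
  then show ?case
    using 0(1) H0 C by (intro exI[of _ f] conjI ballI exI[of _ 0]) auto
next
  case (Suc n)
  note fD = lattice_coordsD[OF Suc.prems(1)]
  have mono: "C i \<subseteq> C j" if "i \<le> j" "j \<le> k" for i j
    using that
  proof (induction j rule: dec_induct)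
    case (step j)
    then show ?case using Suc.prems(5)[of "Suc j"] by auto
  qed simp
  \<comment> \<open>Because the chain may repeat its top member, the last proper member
    \<open>D\<close> is found just before the first occurrence of \<open>H\<close>.\<close>
  define j0 where "j0 = (LEAST j. C j = H)"
  have Cj0: "C j0 = H" and j0k: "j0 \<le> k"
    unfolding j0_def using LeastI[of "\<lambda>j. C j = H" k] Least_le[of "\<lambda>j. C j = H" k] Suc.prems(4) by auto
  have H0: "H \<noteq> {0}"
  proof
    assume "H = {0}"
    then have "f ` H = {0}" using additive_on_0[OF fD(2,1)] by simp
    moreover have "frag_of (Suc n) \<in> f ` H" unfolding fD(4) by simp
    ultimately show False by simp
  qed
  then have j0: "j0 \<in> {1..k}" using Cj0 Suc.prems(3) j0k by (cases j0) auto
  have C_eq: "C i = H" if "j0 \<le> i" "i \<le> k" for i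
    using mono[OF that] mono[of i k] that Cj0 Suc.prems(4) by auto
  define D where "D = C (j0 - 1)"
  have DH: "D \<subseteq> H" using mono[of "j0 - 1" j0] j0 Cj0 by (auto simp: D_def)
  have "D \<noteq> H" unfolding D_def j0_def
    using not_less_Least[of "j0 - 1" "\<lambda>j. C j = H"] j0 by (auto simp: j0_def)
  then obtain x0 where x0: "x0 \<in> H" "x0 \<notin> D" using DH by blast
  \<comment> \<open>Adding \<open>x0\<close> guarantees that the integral functional is nonzero even
    if \<open>S\<close> lies inside \<open>D\<close>.\<close>
  define F where "F = insert x0 (S - D)"
  have F: "finite F" "F \<subseteq> H" using Suc.prems(9,10) x0 by (auto simp: F_def)
  have "L j0 x \<noteq> 0" if "x \<in> F" for x
    using that Suc.prems(8)[OF j0, of x] F x0 Cj0 by (auto simp: F_def D_def)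
  then obtain l where l: "additive_on H l"
    and l0: "\<And>x. x \<in> H \<Longrightarrow> L j0 x = 0 \<Longrightarrow> l x = 0"
    and lsgn: "\<And>x. x \<in> F \<Longrightarrow> of_int (sgn (l x)) = sgn (L j0 x)"
    using lattice_coords_approx[OF Suc.prems(1) Suc.prems(6)[OF j0] F] by metis
  have "L j0 x0 \<noteq> 0" using Suc.prems(8)[OF j0] x0 Cj0 by (auto simp: D_def)
  then have "l x0 \<noteq> 0" using lsgn[of x0] by (auto simp: F_def sgn_zero_iff)
  then obtain d l' e where d: "d > 0" and l': "additive_on H l'" and e: "e \<in> H" "l' e = 1"
      and ll': "\<And>x. x \<in> H \<Longrightarrow> l x = d * l' x"
    using primitive_functional[OF fD(1) l x0(1)] by metis
  have l'sgn: "of_int (sgn (l' x)) = sgn (L j0 x)" if "x \<in> F" for x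
    using lsgn[OF that] ll'[of x] d F that by (auto simp: sgn_mult)
  define K where "K = {x \<in> H. l' x = 0}"
  have K: "additive_subgroup K" "K \<subseteq> H"
    using additive_subgroup_kernel[OF fD(1) l'] by (auto simp: K_def)
  have DK: "D \<subseteq> K"
  proof
    fix x assume "x \<in> D"
    then have "x \<in> H" "l x = 0" using DH l0 Suc.prems(7)[OF j0] by (auto simp: D_def)
    then show "x \<in> K" using ll'[of x] d by (simp add: K_def)
  qed
  obtain m g where g: "lattice_coords m K g"
    using lattice_coords_subgroup[OF Suc.prems(1) K] by blast
  \<comment> \<open>Splitting \<open>H\<close> along \<open>l'\<close> gives it rank
    \<open>Suc m\<close>, so by invariance of the rank the kernel has rank exactly
    \<open>n\<close>.\<close>
  have "Suc m = Suc n"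
    using lattice_coords_extend[OF fD(1) l' e g[unfolded K_def]] Suc.prems(1)
    by (rule lattice_coords_unique)
  then have g: "lattice_coords n K g" using g by simp
  have sub: "additive_subgroup (C j \<inter> K)" if "j \<le> k" for j
    using additive_subgroup_Int[OF Suc.prems(2)[OF that] K(1)] .
  have "\<exists>\<psi>. lattice_coords n K \<psi> \<and>
    (\<forall>j\<in>{1..k}. \<exists>r. lattice_coords r (C j \<inter> K) \<psi> \<and>
       (\<forall>x\<in>S \<inter> K \<inter> (C j \<inter> K - C (j - 1) \<inter> K).
          of_int (sgn (Poly_Mapping.lookup (\<psi> x) r)) = sgn (L j x)))"
  proof (rule Suc.IH[OF g])
    show "additive_subgroup (C j \<inter> K)" if "j \<le> k" for j using sub[OF that] .
    show "C 0 \<inter> K = {0}" using additive_subgroup_0[OF K(1)] Suc.prems(3) by auto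
    show "C k \<inter> K = K" using K Suc.prems(4) by auto
    show "C (j - 1) \<inter> K \<subseteq> C j \<inter> K" if "j \<in> {1..k}" for j using Suc.prems(5)[OF that] by auto
    show "additive_on K (L j)" if "j \<in> {1..k}" for j
      using additive_on_subset[OF Suc.prems(6)[OF that] K(2)] .
    show "L j x = 0" if "j \<in> {1..k}" "x \<in> C (j - 1) \<inter> K" for j x
      using Suc.prems(7) that by auto
    show "L j x \<noteq> 0" if "j \<in> {1..k}" "x \<in> C j \<inter> K - C (j - 1) \<inter> K" for j x
      using Suc.prems(8) that by auto
    show "finite (S \<inter> K)" "S \<inter> K \<subseteq> K" using Suc.prems(9) by auto
  qed
  then obtain \<phi> where \<phi>: "lattice_coords n K \<phi>"
    and \<phi>C: "\<And>j. j \<in> {1..k} \<Longrightarrow> \<exists>r. lattice_coords r (C j \<inter> K) \<phi> \<and>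
       (\<forall>x\<in>S \<inter> K \<inter> (C j \<inter> K - C (j - 1) \<inter> K).
          of_int (sgn (Poly_Mapping.lookup (\<phi> x) r)) = sgn (L j x))"
    by blast
  define \<psi> where "\<psi> = (\<lambda>x. \<phi> (x - frag_cmul (l' x) e) + frag_cmul (l' x) (frag_of (Suc n)))"
  have \<psi>: "lattice_coords (Suc n) H \<psi>"
    unfolding \<psi>_def using lattice_coords_extend[OF fD(1) l' e \<phi>[unfolded K_def]] .
  \<comment> \<open>Hence whatever the induction hypothesis gives for the members \<open>C j\<close>
    with \<open>j < j0\<close>, which lie in \<open>D\<close> and so in \<open>K\<close>, passes
    from \<open>\<phi>\<close> to \<open>\<psi>\<close>.\<close>
  have \<psi>K: "\<psi> x = \<phi> x" if "x \<in> K" for x using that by (simp add: \<psi>_def K_def)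
  have last: "Poly_Mapping.lookup (\<psi> x) (Suc n) = l' x" if "x \<in> H" for x
  proof -
    have "x - frag_cmul (l' x) e \<in> K"
      using that fD(1) l' e by (simp add: K_def additive_subgroup_diff additive_subgroup_cmul
        additive_on_diff additive_on_cmul)
    from lattice_coords_keys[OF \<phi> this]
    have "Suc n \<notin> Poly_Mapping.keys (\<phi> (x - frag_cmul (l' x) e))" by auto
    then show ?thesis by (simp add: \<psi>_def lookup_add in_keys_iff)
  qed
  show ?case
  proof (intro exI[of _ \<psi>] conjI \<psi> ballI)
    fix j assume j: "j \<in> {1..k}"
    show "\<exists>r. lattice_coords r (C j) \<psi> \<and>
       (\<forall>x\<in>S \<inter> (C j - C (j - 1)). of_int (sgn (Poly_Mapping.lookup (\<psi> x) r)) = sgn (L j x))"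
    proof (cases "j < j0")
      case True
      then have "C j \<subseteq> D" using mono[of j "j0 - 1"] j0 by (auto simp: D_def)
      then have CK: "C j \<subseteq> K" using DK by blast
      then have CK': "C j \<inter> K = C j" by blast
      obtain r where r: "lattice_coords r (C j) \<phi>"
        and rs: "\<And>x. x \<in> S \<inter> K \<inter> (C j - C (j - 1) \<inter> K) \<Longrightarrow>
          of_int (sgn (Poly_Mapping.lookup (\<phi> x) r)) = sgn (L j x)"
        using \<phi>C[OF j] unfolding CK' by blast
      have "lattice_coords r (C j) \<psi>"
        using lattice_coords_cong[OF r, of \<psi>] \<psi>K CK by (metis subsetD)
      moreover have "of_int (sgn (Poly_Mapping.lookup (\<psi> x) r)) = sgn (L j x)"
        if "x \<in> S \<inter> (C j - C (j - 1))" for x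
        using rs[of x] \<psi>K[of x] that CK by auto
      ultimately show ?thesis by blast
    next
      case False
      then have Cj: "C j = H" using C_eq[of j] j by simp
      have "of_int (sgn (Poly_Mapping.lookup (\<psi> x) (Suc n))) = sgn (L j x)"
        if x: "x \<in> S \<inter> (C j - C (j - 1))" for x
      proof -
        \<comment> \<open>Beyond \<open>j0\<close> the chain is constant, so only
          \<open>j = j0\<close> has a nonempty difference, and there the last coordinate
          \<open>l'\<close> has the sign of \<open>L j0\<close>.\<close>
        have "\<not> j0 \<le> j - 1" using x C_eq[of "j - 1"] j Cj by auto
        then have "j = j0" using False by linarith
        then show ?thesis using x l'sgn[of x] last[of x] Cj by (auto simp: F_def D_def)
      qed
      then show ?thesis using \<psi> Cj by blast
    qed
  qed
qed

section \<open>Orders on the integer lattice and the conclusion\<close>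

lemma lex_orderI:
  assumes "Poly_Mapping.keys y \<subseteq> {1..r}" "r \<le> N" "Poly_Mapping.lookup y r > 0"
  shows "y \<in> lex_order N"
proof -
  have "r \<in> {1..N}"
    using assms by (auto simp: subset_iff in_keys_iff)
  moreover have "y \<in> carrier (int_lattice N)"
    using assms(1,2) by (simp add: subset_iff) fastforce
  moreover have "Poly_Mapping.lookup y i = 0" if "i \<in> {r<..N}" for i
    using assms(1) that by (auto simp: subset_iff in_keys_iff)
  ultimately show ?thesis
    using assms(3) by (auto simp: lex_order_def)
qed

lemma set_inv_int_lattice:
  assumes "A \<subseteq> carrier (int_lattice N)"
  shows "set_inv\<^bsub>int_lattice N\<^esub> A = uminus ` A"
  using assms by (auto simp: SET_INV_def subset_iff)

lemma subgroup_imp_additive_subgroup: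
  assumes "subgroup H (free_Abelian_group A)"
  shows "additive_subgroup H"
  unfolding additive_subgroup_def
proof (intro conjI ballI)
  interpret subgroup H "free_Abelian_group A" by fact
  show "0 \<in> H" using one_closed by simp
  fix x y assume xy: "x \<in> H" "y \<in> H"
  have "Poly_Mapping.keys y \<subseteq> A" using subsetD[OF subset xy(2)] by simp
  then have "- y \<in> H" using m_inv_closed[OF xy(2)] by simp
  from m_closed[OF xy(1) this] show "x - y \<in> H" by simp
qed

theorem theorem2p7:
  fixes N k :: nat
    and P S :: "(nat \<Rightarrow>\<^sub>0 int) set"
    and C :: "nat \<Rightarrow> (nat \<Rightarrow>\<^sub>0 int) set"
    and L :: "nat \<Rightarrow> (nat \<Rightarrow>\<^sub>0 int) \<Rightarrow> real"
  assumes "N \<ge> 1"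
    and "group_order (int_lattice N) P"
    and "S \<subseteq> carrier (int_lattice N)" and "finite S" and "S \<noteq> {}"
    and "\<And>j. j \<le> k \<Longrightarrow> subgroup (C j) (int_lattice N)"
    and "C 0 = {0}" and "C k = carrier (int_lattice N)"
    and "\<And>j. j \<in> {1..k} \<Longrightarrow> C (j - 1) \<subset> C j"
    and "\<And>j. j \<in> {1..k} \<Longrightarrow> L j \<in> hom (int_lattice N) real_add_group"
    and "\<And>j. j \<in> {1..k} \<Longrightarrow> L j ` C (j - 1) = {0}"
    and "\<And>j \<chi>. j \<in> {1..k} \<Longrightarrow> \<chi> \<in> C j - C (j - 1) \<Longrightarrow>
           order_sgn (int_lattice N) P \<chi> = sgn (L j \<chi>)"
  shows "\<exists>\<psi> \<in> iso (int_lattice N) (int_lattice N).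
           \<psi> ` (S \<inter> P) \<subseteq> lex_order N \<and>
           \<psi> ` (S \<inter> (set_inv\<^bsub>int_lattice N\<^esub> P)) \<subseteq> (set_inv\<^bsub>int_lattice N\<^esub> (lex_order N)) \<and>
           (\<forall>j\<in>{1..k}. \<psi> ` (S \<inter> (C j - C (j - 1))) =
              last_nonzero_at N (\<psi> ` S) (free_rank (int_lattice N) (C j)))"
proof -
  let ?G = "int_lattice N"
  have sub: "additive_subgroup (C j)" and CG: "C j \<subseteq> carrier ?G" if "j \<le> k" for j
    using assms(6)[OF that] subgroup_imp_additive_subgroup subgroup.subset by blast+
  have Cmem: "x \<in> carrier ?G" if "j \<in> {1..k}" "x \<in> C j" for j x
    using subsetD[OF CG[of j] that(2)] that(1) by simp
  have id: "lattice_coords N (carrier ?G) id"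
    using sub[of k] assms(8) by (simp add: lattice_coords_def additive_on_def)
  have L_add: "additive_on (carrier ?G) (L j)" if "j \<in> {1..k}" for j
    using assms(10)[OF that] by (simp add: hom_def additive_on_def real_add_group_def)
  have L_zero: "L j x = 0" if "j \<in> {1..k}" "x \<in> C (j - 1)" for j x
    using imageI[OF that(2), of "L j"] unfolding assms(11)[OF that(1)] by simp
  \<comment> \<open>An element outside \<open>C (j - 1)\<close> is not 0, and the order decides
    every nonzero element, so its sign is not 0.\<close>
  have L_nz: "L j x \<noteq> 0" if "j \<in> {1..k}" "x \<in> C j - C (j - 1)" for j x
  proof -
    have "x \<in> carrier ?G"
      using that Cmem by blast
    moreover have "x \<noteq> 0"
      using that additive_subgroup_0[OF sub[of "j - 1"]] by fastforce
    moreover have "P \<union> set_inv\<^bsub>?G\<^esub> P = carrier ?G"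
      using assms(2) by (simp add: group_order_def)
    ultimately have "order_sgn ?G P x \<noteq> 0"
      by (auto simp: order_sgn_def)
    then show ?thesis using assms(12)[OF that] by (simp add: sgn_zero_iff)
  qed
  have C_mono: "C (j - 1) \<subseteq> C j" if "j \<in> {1..k}" for j
    using assms(9)[OF that] by blast
  obtain \<psi> where \<psi>: "lattice_coords N (carrier ?G) \<psi>"
    and "\<forall>j\<in>{1..k}. \<exists>r. lattice_coords r (C j) \<psi> \<and>
       (\<forall>x\<in>S \<inter> (C j - C (j - 1)). of_int (sgn (Poly_Mapping.lookup (\<psi> x) r)) = sgn (L j x))"
    using adapted_lattice_coords[OF id, where C = C and L = L and k = k and S = S,
        OF sub assms(7,8) C_mono L_add L_zero L_nz assms(4,3)]
    by blast
  then obtain r where r: "\<And>j. j \<in> {1..k} \<Longrightarrow> lattice_coords (r j) (C j) \<psi>"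
    and rs: "\<And>j x. j \<in> {1..k} \<Longrightarrow> x \<in> S \<inter> (C j - C (j - 1)) \<Longrightarrow>
      of_int (sgn (Poly_Mapping.lookup (\<psi> x) (r j))) = sgn (L j x)"
    by metis
  note \<psi>D = lattice_coordsD[OF \<psi>]
  have \<psi>0: "\<psi> 0 = 0" using additive_on_0[OF \<psi>D(2,1)] .
  have rank: "free_rank ?G (C j) = r j" if "j \<in> {1..k}" for j
    using free_rank_eq[OF r[OF that] CG] that by simp
  \<comment> \<open>Since \<open>\<psi>\<close> is injective and maps \<open>C j\<close> onto the
    vectors supported on \<open>{1..r j}\<close>, \<open>C j\<close> is the full preimage of those
    vectors. Strict growth of the ranks follows.\<close>
  have inC: "x \<in> C j" if j: "j \<in> {1..k}" and x: "x \<in> carrier ?G"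
    and keys: "Poly_Mapping.keys (\<psi> x) \<subseteq> {1..r j}" for j x
  proof -
    obtain y where "y \<in> C j" "\<psi> y = \<psi> x" using lattice_coords_surj[OF r[OF j] keys] .
    then show ?thesis using inj_onD[OF \<psi>D(3), of y x] Cmem[OF j] x by metis
  qed
  have r_less: "r i < r j" if "i \<in> {1..k}" "j \<in> {1..k}" "C i \<subset> C j" for i j
  proof (rule ccontr)
    assume "\<not> r i < r j"
    have "C j \<subseteq> C i"
    proof
      fix x assume x: "x \<in> C j"
      then have "Poly_Mapping.keys (\<psi> x) \<subseteq> {1..r i}"
        using lattice_coords_keys[OF r[OF that(2)] x] \<open>\<not> r i < r j\<close> by fastforce
      then show "x \<in> C i" using inC[OF that(1)] Cmem[OF that(2) x] by blast
    qed
    then show False using that(3) by blast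
  qed
  have rN: "r j \<le> N" if "j \<in> {1..k}" for j
  proof -
    have "r j \<le> N" if pos: "r j > 0"
    proof -
      \<comment> \<open>The unit vector at \<open>r j\<close> is an image under
        \<open>\<psi>\<close>, hence supported in \<open>{1..N}\<close>.\<close>
      obtain x where x: "x \<in> C j" "\<psi> x = frag_of (r j)"
        using lattice_coords_surj[OF r[OF \<open>j \<in> {1..k}\<close>], of "frag_of (r j)"] pos
        by (auto simp: keys_frag_of)
      then show ?thesis
        using lattice_coords_keys[OF \<psi> Cmem[OF \<open>j \<in> {1..k}\<close> x(1)]] by (simp add: keys_frag_of)
    qed
    then show ?thesis by (cases "r j = 0") auto
  qed
  have level: "\<exists>j\<in>{1..k}. x \<in> C j - C (j - 1)" if "x \<in> carrier ?G" "x \<noteq> 0" for x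
  proof -
    define j where "j = (LEAST j. x \<in> C j)"
    have xk: "x \<in> C k" using that assms(8) by simp
    have j: "x \<in> C j" "j \<le> k"
      unfolding j_def by (rule LeastI[of "\<lambda>j. x \<in> C j", OF xk], rule Least_le[of "\<lambda>j. x \<in> C j", OF xk])
    \<comment> \<open>The least member containing \<open>x\<close> is not \<open>C 0\<close>, which
      is trivial, so it has a predecessor that misses \<open>x\<close>.\<close>
    have "j \<noteq> 0" using j assms(7) that(2) by (metis singletonD)
    moreover have "x \<notin> C (j - 1)"
      using not_less_Least[of "j - 1" "\<lambda>j. x \<in> C j"] \<open>j \<noteq> 0\<close> by (simp add: j_def)
    ultimately show ?thesis using j by (intro bexI[of _ j]) auto
  qed
  have P: "P \<subseteq> carrier ?G" "P \<inter> set_inv\<^bsub>?G\<^esub> P = {0}"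
    using assms(2) by (auto simp: group_order_def)
  have keys: "Poly_Mapping.keys (\<psi> x) \<subseteq> {1..r j}" if "j \<in> {1..k}" "x \<in> C j" for j x
    using lattice_coords_keys[OF r[OF that(1)] that(2)] .
  show ?thesis
  proof (intro bexI[of _ \<psi>] conjI ballI)
    show "\<psi> \<in> iso ?G ?G"
      using \<psi> by (auto simp: iso_def hom_def lattice_coords_def additive_on_def bij_betw_def)
    show "\<psi> ` (S \<inter> P) \<subseteq> lex_order N"
    proof (rule image_subsetI)
      fix x assume x: "x \<in> S \<inter> P"
      show "\<psi> x \<in> lex_order N"
      proof (cases "x = 0")
        case True
        then show ?thesis using \<psi>0 by (simp add: lex_order_def)
      next
        case False
        then obtain j where j: "j \<in> {1..k}" "x \<in> C j - C (j - 1)" using level P(1) x by blast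
        \<comment> \<open>Needed because \<open>order_sgn\<close> tests membership in the negative
          cone first.\<close>
        have "x \<notin> set_inv\<^bsub>?G\<^esub> P" using P(2) False x by blast
        then have "order_sgn ?G P x = 1" using False x by (simp add: order_sgn_def)
        then have "sgn (L j x) = 1" using assms(12)[OF j] by simp
        then have "real_of_int (sgn (Poly_Mapping.lookup (\<psi> x) (r j))) = 1"
          using rs[OF j(1), of x] j x by simp
        then have "Poly_Mapping.lookup (\<psi> x) (r j) > 0" by (simp add: sgn_1_pos)
        then show ?thesis using lex_orderI[OF keys rN] j by blast
      qed
    qed
    show "\<psi> ` (S \<inter> set_inv\<^bsub>?G\<^esub> P) \<subseteq> set_inv\<^bsub>?G\<^esub> lex_order N"
    proof (rule image_subsetI)
      fix x assume x: "x \<in> S \<inter> set_inv\<^bsub>?G\<^esub> P"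
      have "- \<psi> x \<in> lex_order N"
      proof (cases "x = 0")
        case True
        then show ?thesis using \<psi>0 by (simp add: lex_order_def)
      next
        case False
        then obtain j where j: "j \<in> {1..k}" "x \<in> C j - C (j - 1)" using level assms(3) x by blast
        have "order_sgn ?G P x = - 1" using False x by (simp add: order_sgn_def)
        then have "sgn (L j x) = - 1" using assms(12)[OF j] by simp
        then have "real_of_int (sgn (Poly_Mapping.lookup (\<psi> x) (r j))) = - 1"
          using rs[OF j(1), of x] j x by simp
        then have "Poly_Mapping.lookup (- \<psi> x) (r j) > 0" by (simp add: sgn_if split: if_splits)
        moreover have "Poly_Mapping.keys (- \<psi> x) \<subseteq> {1..r j}"
          unfolding keys_minus using keys j by blast
        ultimately show ?thesis using lex_orderI rN j by blast
      qed
      moreover have "lex_order N \<subseteq> carrier ?G" by (auto simp: lex_order_def)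
      ultimately show "\<psi> x \<in> set_inv\<^bsub>?G\<^esub> lex_order N"
        by (metis add.inverse_inverse imageI set_inv_int_lattice)
    qed
    fix j assume j: "j \<in> {1..k}"
    show "\<psi> ` (S \<inter> (C j - C (j - 1))) = last_nonzero_at N (\<psi> ` S) (free_rank ?G (C j))"
      unfolding rank[OF j]
    proof (intro equalityI subsetI)
      fix y assume "y \<in> \<psi> ` (S \<inter> (C j - C (j - 1)))"
      then obtain x where x: "x \<in> S" "x \<in> C j - C (j - 1)" "y = \<psi> x" by blast
      have "Poly_Mapping.lookup y (r j) \<noteq> 0"
        using rs[OF j, of x] L_nz[OF j x(2)] x
        by (auto simp: sgn_zero_iff)
      moreover have "Poly_Mapping.lookup y i = 0" if "i \<in> {r j<..N}" for i
        using keys[OF j, of x] x that by (auto simp: subset_iff in_keys_iff)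
      ultimately show "y \<in> last_nonzero_at N (\<psi> ` S) (r j)"
        using x by (auto simp: last_nonzero_at_def)
    next
      fix y assume y: "y \<in> last_nonzero_at N (\<psi> ` S) (r j)"
      then obtain x where x: "x \<in> S" "y = \<psi> x" by (auto simp: last_nonzero_at_def)
      have yr: "Poly_Mapping.lookup y (r j) \<noteq> 0"
        and y0: "\<And>i. i \<in> {r j<..N} \<Longrightarrow> Poly_Mapping.lookup y i = 0"
        using y by (auto simp: last_nonzero_at_def)
      have xG: "x \<in> carrier ?G" using x assms(3) by blast
      have "Poly_Mapping.keys y \<subseteq> {1..r j}"
      proof
        fix i assume i: "i \<in> Poly_Mapping.keys y"
        then have "i \<in> {1..N}" using lattice_coords_keys[OF \<psi> xG] x by blast
        moreover have "\<not> r j < i" using y0[of i] i \<open>i \<in> {1..N}\<close> by (auto simp: in_keys_iff)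
        ultimately show "i \<in> {1..r j}" by simp
      qed
      then have xC: "x \<in> C j" using inC[OF j xG] x by simp
      have "x \<notin> C (j - 1)"
      proof
        assume xC': "x \<in> C (j - 1)"
        show False
        \<comment> \<open>The function \<open>r\<close> is specified only on \<open>{1..k}\<close>,
          so \<open>C 0\<close> is treated separately. Otherwise membership in
          \<open>C (j - 1)\<close> would confine the support below \<open>r j\<close>, where
          \<open>y\<close> has a nonzero entry.\<close>
        proof (cases "j = 1")
          case True
          then show False using xC' assms(7) yr x \<psi>0 by simp
        next
          case False
          then have j': "j - 1 \<in> {1..k}" using j by auto
          have "r (j - 1) < r j" using r_less[OF j' j assms(9)[OF j]] .
          moreover have "r j \<in> Poly_Mapping.keys y" using yr by (simp add: in_keys_iff)
          ultimately show False using keys[OF j' xC'] x by auto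
        qed
      qed
      then show "y \<in> \<psi> ` (S \<inter> (C j - C (j - 1)))" using x xC by blast
    qed
  qed
qed

end
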